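(* Let $K$ be a field, $L$ an algebraically closed field extension of $K$, $X=\{x_1,\dots,x_n\}$, and let $H=\langle h_1,\dots,h_r\rangle\subseteq K[X]$ (the hypotheses) and $f\in K[X]$ (the thesis) define a statement $\{H\Rightarrow T\}$ with $T=\langle f\rangle$. Let $Y=\{x_1,\dots,x_d\}$ ($0\le d\le n$) be a maximum-size set of independent variables for $H$ (so $d=\dim H$). Then: (a) The statement is generally true if and only if $\langle h_1,\dots,h_r, f\cdot t-1\rangle K[X,t]\cap K[Y]\neq\langle 0\rangle$, where $t$ is a new variable. (b) The statement is generally false if and only if $\langle h_1,\dots,h_r,f\rangle K[X]\cap K[Y]\neq\langle 0\rangle$.
   Context: $V(H)\subseteq L^n$ denotes the common zero set in $L^n$ of the elements of $H$. A set $Y=\{x_1,\dots,x_d\}\subseteq X$ is a maximum-size set of independent variables for $H$ if (i) $H\cap K[Y]=\langle 0\rangle$ and (ii) for every subset $Z\subseteq X$ with more than $d$ elements, $H\cap K[Z]\neq\langle 0\rangle$. The $K$-components of $V(H)$ are its irreducible components as a variety defined over $K$, i.e. the zero sets in $L^n$ of the minimal prime ideals of $H$ in $K[X]$; for such a component $W$, let $I(W)\subseteq K[X]$ be the ideal of polynomials over $K$ vanishing on $W$ (its associated prime). A $K$-component $W$ is non-degenerate (with respect to $Y$) if $I(W)\cap K[Y]=\langle 0\rangle$, and degenerate otherwise. The statement is generally true if $f$ vanishes on all non-degenerate $K$-components of $V(H)$, and generally false if $f$ vanishes identically on none of the non-degenerate $K$-components of $V(H)$. *)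

theory Defs
  imports "HOL-Library.Poly_Mapping" "HOL-Computational_Algebra.Polynomial"
begin

text \<open>Multivariate polynomials in the variables x_0, x_1, ... with coefficients in a type 'a:
  maps from monomials (finitely supported exponent vectors) to coefficients.\<close>
type_synonym 'a mpol = "(nat \<Rightarrow>\<^sub>0 nat) \<Rightarrow>\<^sub>0 'a"

text \<open>K is a subfield of the (algebraically closed) field L = the ambient type.\<close>
definition is_subfield :: "'a::field set \<Rightarrow> bool" where
  "is_subfield K \<longleftrightarrow> 0 \<in> K \<and> 1 \<in> K \<and> (\<forall>a\<in>K. \<forall>b\<in>K. a + b \<in> K \<and> a * b \<in> K) \<and>
     (\<forall>a\<in>K. - a \<in> K) \<and> (\<forall>a\<in>K. a \<noteq> 0 \<longrightarrow> inverse a \<in> K)"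

definition Var :: "nat \<Rightarrow> 'a::comm_ring_1 mpol" where
  "Var i = Poly_Mapping.single (Poly_Mapping.single i 1) 1"

definition poly_over :: "'a::zero set \<Rightarrow> nat set \<Rightarrow> 'a mpol \<Rightarrow> bool" where
  "poly_over K V p \<longleftrightarrow> (\<forall>m. Poly_Mapping.lookup p m \<in> K) \<and> (\<forall>m\<in>Poly_Mapping.keys p. Poly_Mapping.keys m \<subseteq> V)"

definition meval :: "'a::comm_ring_1 mpol \<Rightarrow> (nat \<Rightarrow> 'a) \<Rightarrow> 'a" where
  "meval p a = (\<Sum>m\<in>Poly_Mapping.keys p. Poly_Mapping.lookup p m * (\<Prod>i\<in>Poly_Mapping.keys m. a i ^ Poly_Mapping.lookup m i))"

definition ideal_gen :: "'a::comm_ring_1 set \<Rightarrow> nat set \<Rightarrow> 'a mpol list \<Rightarrow> 'a mpol set" where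
  "ideal_gen K V hs = {(\<Sum>i<length hs. c i * hs ! i) | c. \<forall>i<length hs. poly_over K V (c i)}"

text \<open>Ideals and prime ideals of a ring R given as a subring (a set) of an ambient commutative ring.\<close>
definition is_ideal_in :: "'b::comm_ring_1 set \<Rightarrow> 'b set \<Rightarrow> bool" where
  "is_ideal_in R I \<longleftrightarrow> I \<subseteq> R \<and> 0 \<in> I \<and> (\<forall>a\<in>I. \<forall>b\<in>I. a + b \<in> I) \<and>
     (\<forall>r\<in>R. \<forall>a\<in>I. r * a \<in> I)"

definition is_prime_ideal_in :: "'b::comm_ring_1 set \<Rightarrow> 'b set \<Rightarrow> bool" where
  "is_prime_ideal_in R P \<longleftrightarrow> is_ideal_in R P \<and> 1 \<notin> P \<and>
     (\<forall>a\<in>R. \<forall>b\<in>R. a * b \<in> P \<longrightarrow> a \<in> P \<or> b \<in> P)"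

definition minimal_primes :: "'b::comm_ring_1 set \<Rightarrow> 'b set \<Rightarrow> 'b set set" where
  "minimal_primes R H = {P. is_prime_ideal_in R P \<and> H \<subseteq> P \<and>
     (\<forall>Q. is_prime_ideal_in R Q \<and> H \<subseteq> Q \<and> Q \<subseteq> P \<longrightarrow> Q = P)}"

text \<open>Points of L^n are functions a with a i = 0 for i \<ge> n; V(S) is the common zero set in L^n.\<close>
definition zero_set :: "nat \<Rightarrow> 'a::comm_ring_1 mpol set \<Rightarrow> (nat \<Rightarrow> 'a) set" where
  "zero_set n S = {a. (\<forall>i\<ge>n. a i = 0) \<and> (\<forall>p\<in>S. meval p a = 0)}"

definition vanishing_ideal :: "'a::comm_ring_1 set \<Rightarrow> nat \<Rightarrow> (nat \<Rightarrow> 'a) set \<Rightarrow> 'a mpol set" where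
  "vanishing_ideal K n W = {p. poly_over K {..<n} p \<and> (\<forall>a\<in>W. meval p a = 0)}"

definition K_components :: "'a::comm_ring_1 set \<Rightarrow> nat \<Rightarrow> 'a mpol set \<Rightarrow> (nat \<Rightarrow> 'a) set set" where
  "K_components K n H = zero_set n ` minimal_primes {p. poly_over K {..<n} p} H"

definition max_indep_vars :: "'a::comm_ring_1 set \<Rightarrow> nat \<Rightarrow> 'a mpol set \<Rightarrow> nat \<Rightarrow> bool" where
  "max_indep_vars K n H d \<longleftrightarrow> d \<le> n \<and>
     H \<inter> {p. poly_over K {..<d} p} = {0} \<and>
     (\<forall>Z. Z \<subseteq> {..<n} \<and> card Z > d \<longrightarrow> H \<inter> {p. poly_over K Z p} \<noteq> {0})"

definition non_degenerate :: "'a::comm_ring_1 set \<Rightarrow> nat \<Rightarrow> nat \<Rightarrow> (nat \<Rightarrow> 'a) set \<Rightarrow> bool" where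
  "non_degenerate K n d W \<longleftrightarrow> vanishing_ideal K n W \<inter> {p. poly_over K {..<d} p} = {0}"

definition generally_true :: "'a::comm_ring_1 set \<Rightarrow> nat \<Rightarrow> nat \<Rightarrow> 'a mpol set \<Rightarrow> 'a mpol \<Rightarrow> bool" where
  "generally_true K n d H f \<longleftrightarrow>
     (\<forall>W\<in>K_components K n H. non_degenerate K n d W \<longrightarrow> (\<forall>a\<in>W. meval f a = 0))"

definition generally_false :: "'a::comm_ring_1 set \<Rightarrow> nat \<Rightarrow> nat \<Rightarrow> 'a mpol set \<Rightarrow> 'a mpol \<Rightarrow> bool" where
  "generally_false K n d H f \<longleftrightarrow>
     (\<forall>W\<in>K_components K n H. non_degenerate K n d W \<longrightarrow> \<not> (\<forall>a\<in>W. meval f a = 0))"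

end

theory Submission
  imports Defs
begin

text \<open>By the Nullstellensatz, a \<open>K\<close>-component \<open>V(P)\<close> is non-degenerate iff the minimal prime
  \<open>P\<close> of \<open>H\<close> misses \<open>S = K[Y] - {0}\<close>, and \<open>f\<close> vanishes on it iff \<open>f \<in> P\<close>.

  (a) If the elimination ideal is zero, then \<open>H\<close> misses the multiplicative set of all
  \<open>s f\<^sup>k\<close> with \<open>s \<in> S\<close>, so some minimal prime does; it is non-degenerate and does not contain
  \<open>f\<close>. Conversely, evaluating \<open>s \<in> \<langle>H, f t - 1\<rangle> \<inter> K[Y]\<close> at \<open>t = 1 / f\<close> shows that \<open>s f\<close>
  vanishes on \<open>V(H)\<close>.

  (b) If the elimination ideal is zero, a prime \<open>Q \<supseteq> \<langle>H, f\<rangle>\<close> misses \<open>S\<close>. It contains a minimal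
  prime \<open>P\<close> of \<open>H\<close>, which is non-degenerate. Maximality of \<open>Y\<close> makes every variable algebraic
  over \<open>K(Y)\<close> modulo \<open>P\<close>, so \<open>f \<notin> P\<close> would give \<open>f w - s \<in> P\<close> with \<open>s \<in> S\<close>, whence
  \<open>s \<in> Q\<close>. Working with primes that avoid \<open>S\<close> makes it unnecessary to know that there are
  only finitely many minimal primes.\<close>

subsection \<open>Ideals and primes in subrings\<close>

text \<open>All rings in play are subsets of a common ambient ring, so that inclusions such as K[Y]
  in K[X] in K[X,t] are literal and contraction of an ideal is intersection. Closure under
  differences covers sums and negatives at once.\<close>

definition subring :: "'b::comm_ring_1 set \<Rightarrow> bool" where
  "subring R \<longleftrightarrow> 1 \<in> R \<and> (\<forall>a\<in>R. \<forall>b\<in>R. a - b \<in> R \<and> a * b \<in> R)"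

lemma subring_1: "subring R \<Longrightarrow> 1 \<in> R"
  and subring_diff: "subring R \<Longrightarrow> a \<in> R \<Longrightarrow> b \<in> R \<Longrightarrow> a - b \<in> R"
  and subring_mult: "subring R \<Longrightarrow> a \<in> R \<Longrightarrow> b \<in> R \<Longrightarrow> a * b \<in> R"
  by (auto simp: subring_def)

lemma subring_0: "subring R \<Longrightarrow> 0 \<in> R"
  using subring_diff[of R 1 1] by (simp add: subring_1)

lemma subring_uminus: "subring R \<Longrightarrow> a \<in> R \<Longrightarrow> - a \<in> R"
  using subring_diff[of R 0 a] by (simp add: subring_0)

lemma subring_add: "subring R \<Longrightarrow> a \<in> R \<Longrightarrow> b \<in> R \<Longrightarrow> a + b \<in> R"
  using subring_diff[of R a "- b"] by (simp add: subring_uminus)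

lemma subring_power: "subring R \<Longrightarrow> a \<in> R \<Longrightarrow> a ^ k \<in> R"
  by (induction k) (auto simp: subring_1 subring_mult)

lemma subring_sum: "subring R \<Longrightarrow> (\<And>i. i \<in> I \<Longrightarrow> g i \<in> R) \<Longrightarrow> sum g I \<in> R"
  by (induction I rule: infinite_finite_induct) (auto simp: subring_0 subring_add)

lemmas subring_closed = subring_0 subring_1 subring_diff subring_mult subring_uminus subring_add
  subring_power subring_sum

lemma ideal_0: "is_ideal_in R I \<Longrightarrow> 0 \<in> I"
  and ideal_subset: "is_ideal_in R I \<Longrightarrow> a \<in> I \<Longrightarrow> a \<in> R"
  and ideal_add: "is_ideal_in R I \<Longrightarrow> a \<in> I \<Longrightarrow> b \<in> I \<Longrightarrow> a + b \<in> I"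
  and ideal_mult_left: "is_ideal_in R I \<Longrightarrow> r \<in> R \<Longrightarrow> a \<in> I \<Longrightarrow> r * a \<in> I"
  by (auto simp: is_ideal_in_def)

lemma ideal_mult_right: "is_ideal_in R I \<Longrightarrow> r \<in> R \<Longrightarrow> a \<in> I \<Longrightarrow> a * r \<in> I"
  using ideal_mult_left[of R I r a] by (simp add: mult.commute)

lemma ideal_diff:
  assumes "subring R" "is_ideal_in R I" "a \<in> I" "b \<in> I"
  shows "a - b \<in> I"
proof -
  have "(- 1) * b \<in> I"
    using assms by (intro ideal_mult_left) (auto simp: subring_closed)
  then show ?thesis
    using ideal_add[OF assms(2,3), of "- b"] by simp
qed

lemma ideal_diff_cancel:
  assumes "subring R" "is_ideal_in R I" "a - b \<in> I" "b \<in> I"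
  shows "a \<in> I"
  using ideal_add[OF assms(2,3,4)] by simp

lemma prime_ideal: "is_prime_ideal_in R P \<Longrightarrow> is_ideal_in R P"
  and prime_not_1: "is_prime_ideal_in R P \<Longrightarrow> 1 \<notin> P"
  and prime_mult: "is_prime_ideal_in R P \<Longrightarrow> a \<in> R \<Longrightarrow> b \<in> R \<Longrightarrow> a * b \<in> P \<Longrightarrow> a \<in> P \<or> b \<in> P"
  by (auto simp: is_prime_ideal_in_def)

lemma prime_power:
  assumes "subring R" "is_prime_ideal_in R P" "a \<in> R" "a ^ k \<in> P"
  shows "a \<in> P"
  using assms(4)
proof (induction k)
  case 0
  then show ?case using prime_not_1[OF assms(2)] by simp
next
  case (Suc k)
  then show ?case
    using prime_mult[OF assms(2,3), of "a ^ k"] assms by (auto simp: subring_power)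
qed

lemma prime_ideal_restrict:
  assumes "subring A" "A \<subseteq> R" "is_prime_ideal_in R P"
  shows "is_prime_ideal_in A (P \<inter> A)"
  using assms
  by (auto simp: is_prime_ideal_in_def is_ideal_in_def subring_closed subset_iff)

text \<open>Krull's argument: an ideal that is maximal among those containing \<open>H\<close> and
  missing the multiplicative set \<open>S\<close> is prime. Zorn's lemma supplies it, since unions
  of chains of such ideals are again such ideals.\<close>

lemma ex_prime_avoiding:
  assumes R: "subring R" and H: "is_ideal_in R H"
    and S: "1 \<in> S" "S \<subseteq> R" "\<And>a b. a \<in> S \<Longrightarrow> b \<in> S \<Longrightarrow> a * b \<in> S"
    and disj: "H \<inter> S = {}"
  obtains Q where "is_prime_ideal_in R Q" "H \<subseteq> Q" "Q \<inter> S = {}"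
proof -
  define F where "F = {I. is_ideal_in R I \<and> H \<subseteq> I \<and> I \<inter> S = {}}"
  have "\<exists>Q\<in>F. \<forall>X\<in>F. Q \<subseteq> X \<longrightarrow> X = Q"
  proof (rule subset_Zorn_nonempty)
    show "F \<noteq> {}" using H disj by (auto simp: F_def)
    fix C assume ne: "C \<noteq> {}" and C: "subset.chain F C"
    have CF: "C \<subseteq> F" and lin: "\<And>I J. I \<in> C \<Longrightarrow> J \<in> C \<Longrightarrow> I \<subseteq> J \<or> J \<subseteq> I"
      using C by (auto simp: subset.chain_def)
    have ideals: "is_ideal_in R I" if "I \<in> C" for I using that CF by (auto simp: F_def)
    have "is_ideal_in R (\<Union>C)"
      unfolding is_ideal_in_def
    proof (intro conjI ballI)
      show "\<Union>C \<subseteq> R" using ideals ideal_subset by blast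
      show "0 \<in> \<Union>C" using ne ideals ideal_0 by blast
      show "a + b \<in> \<Union>C" if ab: "a \<in> \<Union>C" "b \<in> \<Union>C" for a b
      proof -
        obtain I J where IJ: "I \<in> C" "J \<in> C" "a \<in> I" "b \<in> J" using ab by blast
        show ?thesis
        proof (cases "I \<subseteq> J")
          case True
          then have "a + b \<in> J" using IJ ideals by (intro ideal_add[of R]) auto
          then show ?thesis using IJ by blast
        next
          case False
          then have "J \<subseteq> I" using lin IJ by blast
          then have "a + b \<in> I" using IJ ideals by (intro ideal_add[of R]) auto
          then show ?thesis using IJ by blast
        qed
      qed
      show "r * a \<in> \<Union>C" if "r \<in> R" "a \<in> \<Union>C" for r a
        using that ideals ideal_mult_left by blast
    qed
    then show "\<Union>C \<in> F" using ne CF by (auto simp: F_def)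
  qed
  then obtain Q where Q: "is_ideal_in R Q" "H \<subseteq> Q" "Q \<inter> S = {}"
    and max: "\<And>X. X \<in> F \<Longrightarrow> Q \<subseteq> X \<Longrightarrow> X = Q"
    by (auto simp: F_def)
  \<comment> \<open>The ideal \<open>Q + R a\<close> is strictly larger than \<open>Q\<close>, so by
    maximality it cannot miss \<open>S\<close>.\<close>
  have meets: "\<exists>q\<in>Q. \<exists>r\<in>R. q + r * a \<in> S" if a: "a \<in> R" "a \<notin> Q" for a
  proof (rule ccontr)
    assume none: "\<not> ?thesis"
    define I where "I = {q + r * a |q r. q \<in> Q \<and> r \<in> R}"
    have II: "q + r * a \<in> I" if "q \<in> Q" "r \<in> R" for q r
      using that by (auto simp: I_def)
    have QI: "Q \<subseteq> I" using II[of _ 0] R by (auto simp: subring_closed)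
    have "is_ideal_in R I"
      unfolding is_ideal_in_def
    proof (intro conjI ballI)
      show "I \<subseteq> R" using R Q(1) a by (auto simp: I_def subring_closed ideal_subset)
      show "0 \<in> I" using QI Q(1) ideal_0 by blast
      show "u + v \<in> I" if uv: "u \<in> I" "v \<in> I" for u v
      proof -
        obtain q r q' r' where e: "u = q + r * a" "v = q' + r' * a" "q \<in> Q" "q' \<in> Q" "r \<in> R" "r' \<in> R"
          using uv by (auto simp: I_def)
        have "u + v = (q + q') + (r + r') * a" using e by (simp add: algebra_simps)
        then show ?thesis using II[OF ideal_add[OF Q(1) e(3,4)] subring_add[OF R e(5,6)]] by simp
      qed
      show "s * u \<in> I" if su: "s \<in> R" "u \<in> I" for s u
      proof -
        obtain q r where e: "u = q + r * a" "q \<in> Q" "r \<in> R"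
          using su by (auto simp: I_def)
        have "s * u = s * q + (s * r) * a" using e by (simp add: algebra_simps)
        then show ?thesis using e su R Q(1) II[of "s * q" "s * r"]
          by (simp add: ideal_mult_left subring_closed)
      qed
    qed
    moreover have "I \<inter> S = {}" using none by (auto simp: I_def)
    ultimately have "I \<in> F" using QI Q by (auto simp: F_def)
    then have "I = Q" using max QI by blast
    moreover have "a \<in> I" using II[of 0 1] R Q(1) by (simp add: ideal_0 subring_closed)
    ultimately show False using a by blast
  qed
  have "is_prime_ideal_in R Q"
    unfolding is_prime_ideal_in_def
  proof (intro conjI ballI impI)
    show "is_ideal_in R Q" "1 \<notin> Q" using Q S by auto
    fix a b assume ab: "a \<in> R" "b \<in> R" "a * b \<in> Q"
    show "a \<in> Q \<or> b \<in> Q"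
    proof (rule ccontr)
      assume "\<not> ?thesis"
      then obtain q r q' r' where e: "q \<in> Q" "r \<in> R" "q + r * a \<in> S" "q' \<in> Q" "r' \<in> R" "q' + r' * b \<in> S"
        using meets ab by meson
      \<comment> \<open>The product of two elements of \<open>S\<close> expands into terms each
        containing a factor from \<open>Q\<close>, the last one being \<open>a * b\<close>.\<close>
      have "(q + r * a) * (q' + r' * b) = (q' + r' * b) * q + r * a * q' + r * r' * (a * b)"
        by (simp add: algebra_simps)
      also have "\<dots> \<in> Q"
      proof (intro ideal_add[OF Q(1)])
        show "(q' + r' * b) * q \<in> Q" using ideal_mult_left[OF Q(1)] e S(2) by blast
        show "r * a * q' \<in> Q" using ideal_mult_left[OF Q(1)] subring_mult[OF R] e ab by blast
        show "r * r' * (a * b) \<in> Q" using ideal_mult_left[OF Q(1)] subring_mult[OF R] e ab by blast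
      qed
      finally show False using e S(3) Q(3) by blast
    qed
  qed
  then show ?thesis using that Q by blast
qed

text \<open>Zorn's lemma applied downwards: the intersection of a nonempty chain of primes is prime,
  so there is a minimal one among the primes between \<open>H\<close> and \<open>Q\<close>.\<close>

lemma ex_minimal_prime_below:
  assumes R: "subring R" and Q: "is_prime_ideal_in R Q" "H \<subseteq> Q"
  obtains P where "P \<in> minimal_primes R H" "P \<subseteq> Q"
proof -
  \<comment> \<open>Passing to complements in \<open>R\<close> turns minimal primes into maximal
    sets and intersections of primes into unions.\<close>
  define F where "F = (\<lambda>P. R - P) ` {P. is_prime_ideal_in R P \<and> H \<subseteq> P \<and> P \<subseteq> Q}"
  have "\<exists>M\<in>F. \<forall>X\<in>F. M \<subseteq> X \<longrightarrow> X = M"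
  proof (rule subset_Zorn_nonempty)
    show "F \<noteq> {}" using Q by (auto simp: F_def)
    fix C assume ne: "C \<noteq> {}" and C: "subset.chain F C"
    define D where "D = {P. is_prime_ideal_in R P \<and> H \<subseteq> P \<and> P \<subseteq> Q \<and> R - P \<in> C}"
    have linC: "X \<subseteq> Y \<or> Y \<subseteq> X" if "X \<in> C" "Y \<in> C" for X Y
      using C that by (simp add: subset_chain_def)
    have CD: "C = (\<lambda>P. R - P) ` D"
    proof
      show "C \<subseteq> (\<lambda>P. R - P) ` D"
        using C unfolding subset_chain_def F_def D_def by blast
    qed (auto simp: D_def)
    have PR: "P \<subseteq> R" "is_ideal_in R P" "1 \<notin> P"
      and Pprime: "\<And>a b. a \<in> R \<Longrightarrow> b \<in> R \<Longrightarrow> a * b \<in> P \<Longrightarrow> a \<in> P \<or> b \<in> P" if "P \<in> D" for P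
    proof -
      have P: "is_prime_ideal_in R P" using that by (simp add: D_def)
      show "P \<subseteq> R" "is_ideal_in R P" "1 \<notin> P" "\<And>a b. a \<in> R \<Longrightarrow> b \<in> R \<Longrightarrow> a * b \<in> P \<Longrightarrow> a \<in> P \<or> b \<in> P"
        using ideal_subset[OF prime_ideal[OF P]] prime_ideal[OF P] prime_not_1[OF P] prime_mult[OF P] by blast+
    qed
    have lin: "P \<subseteq> P' \<or> P' \<subseteq> P" if PP: "P \<in> D" "P' \<in> D" for P P'
    proof -
      have "R - P \<in> C" "R - P' \<in> C" using PP by (auto simp: D_def)
      then have "R - P \<subseteq> R - P' \<or> R - P' \<subseteq> R - P"
        by (rule linC)
      moreover have "X \<subseteq> Y" if "R - Y \<subseteq> R - X" "X \<in> D" for X Y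
        using that PR(1)[OF that(2)] by blast
      ultimately show ?thesis using PP by blast
    qed
    obtain P0 where P0: "P0 \<in> D" using ne CD by blast
    have "is_ideal_in R (\<Inter>D)"
      unfolding is_ideal_in_def
    proof (intro conjI ballI)
      show "\<Inter>D \<subseteq> R" using P0 PR(1) by blast
      show "0 \<in> \<Inter>D" using ideal_0[OF PR(2)] by blast
      show "a + b \<in> \<Inter>D" if "a \<in> \<Inter>D" "b \<in> \<Inter>D" for a b
        using that ideal_add[OF PR(2)] by blast
      show "r * a \<in> \<Inter>D" if "r \<in> R" "a \<in> \<Inter>D" for r a
        using that ideal_mult_left[OF PR(2)] by blast
    qed
    moreover have "a \<in> \<Inter>D \<or> b \<in> \<Inter>D" if ab: "a \<in> R" "b \<in> R" "a * b \<in> \<Inter>D" for a b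
    proof (rule ccontr)
      assume "\<not> ?thesis"
      then obtain P P' where P: "P \<in> D" "P' \<in> D" "a \<notin> P" "b \<notin> P'" by blast
      \<comment> \<open>Primality puts the missing factors crosswise; the smaller of the two primes
        then forces \<open>a\<close> into \<open>P\<close> or \<open>b\<close> into
        \<open>P'\<close>.\<close>
      then have "a \<in> P'" "b \<in> P" using Pprime[OF P(1) ab(1,2)] Pprime[OF P(2) ab(1,2)] ab(3) by auto
      then show False using lin[OF P(1,2)] P by blast
    qed
    ultimately have "is_prime_ideal_in R (\<Inter>D)"
      using P0 PR(3)[OF P0] unfolding is_prime_ideal_in_def by blast
    moreover have "H \<subseteq> \<Inter>D" "\<Inter>D \<subseteq> Q" using P0 by (auto simp: D_def)
    moreover have "\<Union>C = R - \<Inter>D" using CD by auto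
    ultimately show "\<Union>C \<in> F" by (auto simp: F_def)
  qed
  then obtain P where P: "is_prime_ideal_in R P" "H \<subseteq> P" "P \<subseteq> Q"
    and max: "\<And>P'. is_prime_ideal_in R P' \<Longrightarrow> H \<subseteq> P' \<Longrightarrow> P' \<subseteq> Q \<Longrightarrow> R - P \<subseteq> R - P' \<Longrightarrow> R - P' = R - P"
    by (auto simp: F_def)
  have "P \<in> minimal_primes R H"
    unfolding minimal_primes_def
  proof (intro CollectI conjI allI impI; (elim conjE)?)
    fix P' assume P': "is_prime_ideal_in R P'" "H \<subseteq> P'" "P' \<subseteq> P"
    then have "R - P' = R - P" using P by (intro max) auto
    moreover have "P \<subseteq> R" "P' \<subseteq> R"
      using P(1) P'(1) by (auto simp: is_prime_ideal_in_def is_ideal_in_def)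
    ultimately show "P' = P" using P' by blast
  qed (use P in auto)
  then show ?thesis using that P by blast
qed

subsection \<open>Primes in simple ring extensions\<close>

definition polys_over :: "'b::comm_ring_1 set \<Rightarrow> 'b poly set" where
  "polys_over A = {p. \<forall>i. coeff p i \<in> A}"

lemma subring_polys_over:
  assumes A: "subring A"
  shows "subring (polys_over A)"
  unfolding subring_def[of "polys_over A"]
  using A by (auto simp: polys_over_def coeff_mult coeff_1 subring_0 subring_1
    intro!: subring_diff subring_mult subring_sum)

lemma monom_polys_over: "subring A \<Longrightarrow> a \<in> A \<Longrightarrow> monom a k \<in> polys_over A"
  by (auto simp: polys_over_def subring_closed)

lemma smult_polys_over: "subring A \<Longrightarrow> a \<in> A \<Longrightarrow> p \<in> polys_over A \<Longrightarrow> smult a p \<in> polys_over A"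
  by (auto simp: polys_over_def subring_closed)

lemma coeff_polys_over: "p \<in> polys_over A \<Longrightarrow> coeff p i \<in> A"
  by (auto simp: polys_over_def)

lemmas polys_over_closed = monom_polys_over smult_polys_over subring_closed[OF subring_polys_over]

definition adjoin :: "'b::comm_ring_1 set \<Rightarrow> 'b \<Rightarrow> 'b set" where
  "adjoin A x = (\<lambda>q. poly q x) ` polys_over A"

lemma poly_adjoin: "q \<in> polys_over A \<Longrightarrow> poly q x \<in> adjoin A x"
  by (auto simp: adjoin_def)

lemma subring_adjoin:
  assumes A: "subring A"
  shows "subring (adjoin A x)"
proof -
  note P = subring_polys_over[OF A]
  show ?thesis
    unfolding subring_def
  proof (intro conjI ballI)
    show "1 \<in> adjoin A x" using poly_adjoin[OF subring_1[OF P], of x] by simp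
    fix a b assume "a \<in> adjoin A x" "b \<in> adjoin A x"
    then obtain p q where pq: "p \<in> polys_over A" "q \<in> polys_over A" "a = poly p x" "b = poly q x"
      by (auto simp: adjoin_def)
    show "a - b \<in> adjoin A x" "a * b \<in> adjoin A x"
      using poly_adjoin[OF subring_diff[OF P pq(1,2)], of x]
        poly_adjoin[OF subring_mult[OF P pq(1,2)], of x] pq by auto
  qed
qed

lemma adjoin_base: "subring A \<Longrightarrow> a \<in> A \<Longrightarrow> a \<in> adjoin A x"
  using poly_adjoin[OF monom_polys_over, of A a 0 x] by (simp add: poly_monom)

lemma adjoin_generator: "subring A \<Longrightarrow> x \<in> adjoin A x"
  using poly_adjoin[OF monom_polys_over, of A 1 1 x] by (simp add: poly_monom subring_1)

text \<open>The leading coefficient of \<open>G\<close> need not be invertible in \<open>A\<close>,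
  so a power of it is multiplied onto \<open>F\<close> to make long division possible. The bound on
  the degree of \<open>q\<close> is needed later to conclude that a quotient has smaller degree than
  the minimal polynomial.\<close>

lemma pseudo_division_polys_over:
  fixes F G :: "'b::comm_ring_1 poly"
  assumes A: "subring A" and G: "G \<in> polys_over A" "degree G > 0" and F: "F \<in> polys_over A"
  shows "\<exists>k. \<exists>q\<in>polys_over A. \<exists>r\<in>polys_over A. smult (lead_coeff G ^ k) F = q * G + r \<and>
           degree r < degree G \<and> degree q \<le> degree F - degree G"
  using F
proof (induction "degree F" arbitrary: F rule: less_induct)
  case less
  note F = less.prems
  show ?case
  proof (cases "degree F < degree G")
    case True
    then have "smult (lead_coeff G ^ 0) F = 0 * G + F \<and> degree F < degree G
        \<and> degree (0::'b poly) \<le> degree F - degree G" by simp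
    then show ?thesis using F polys_over_closed[OF A] by blast
  next
    case False
    define l where "l = lead_coeff G"
    define m where "m = monom (lead_coeff F) (degree F - degree G)"
    \<comment> \<open>One division step: the leading terms of \<open>l F\<close> and
      \<open>m G\<close> cancel.\<close>
    define F' where "F' = smult l F - m * G"
    have lA: "l \<in> A" using G by (simp add: l_def coeff_polys_over)
    have m: "m \<in> polys_over A" using F A by (simp add: m_def polys_over_closed coeff_polys_over)
    have F'A: "F' \<in> polys_over A"
      unfolding F'_def using A lA m F G by (intro polys_over_closed) auto
    have "degree (m * G) \<le> degree F"
      using degree_mult_le[of m G] degree_monom_le[of "lead_coeff F" "degree F - degree G"] False
      unfolding m_def by linarith
    then have "degree F' \<le> degree F"
      unfolding F'_def by (intro degree_diff_le order_trans[OF degree_smult_le]) auto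
    moreover have "coeff F' (degree F) = 0"
      using False by (simp add: F'_def m_def l_def coeff_monom_mult)
    moreover have "degree F > 0" using False G by linarith
    ultimately have deg: "degree F' < degree F"
      by (metis eq_zero_or_degree_less degree_0)
    then obtain k q r where IH: "q \<in> polys_over A" "r \<in> polys_over A"
      "smult (l ^ k) F' = q * G + r" "degree r < degree G" "degree q \<le> degree F' - degree G"
      using less.hyps[OF deg F'A] by (auto simp: l_def)
    have "smult (l ^ Suc k) F = smult (l ^ k) F' + smult (l ^ k) (m * G)"
      by (simp add: F'_def smult_diff_right mult.commute)
    also have "\<dots> = (q + smult (l ^ k) m) * G + r"
      using IH(3) by (simp add: algebra_simps)
    finally have eq: "smult (l ^ Suc k) F = (q + smult (l ^ k) m) * G + r" .
    have "degree (q + smult (l ^ k) m) \<le> degree F - degree G"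
    proof (rule degree_add_le)
      show "degree q \<le> degree F - degree G" using IH(5) deg by linarith
      show "degree (smult (l ^ k) m) \<le> degree F - degree G"
        unfolding m_def by (intro order_trans[OF degree_smult_le] degree_monom_le)
    qed
    moreover have "q + smult (l ^ k) m \<in> polys_over A"
      using A IH m lA by (intro polys_over_closed) (auto simp: subring_closed)
    ultimately show ?thesis using eq IH unfolding l_def by blast
  qed
qed

lemma poly_drop_lead:
  fixes p :: "'b::comm_ring_1 poly"
  assumes "degree p > 0"
  shows "degree (p - monom (lead_coeff p) (degree p)) < degree p"
proof -
  let ?p = "p - monom (lead_coeff p) (degree p)"
  have "degree ?p \<le> degree p"
    by (intro degree_diff_le) (auto simp: degree_monom_le)
  moreover have "coeff ?p (degree p) = 0" by simp
  ultimately show ?thesis using assms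
    by (metis eq_zero_or_degree_less degree_0)
qed

text \<open>The setting is a simple extension of the domain \<open>A / (P \<inter> A)\<close> by the
  residue class of \<open>x\<close>. Quotients and fraction fields are avoided by expressing
  everything through membership in \<open>P\<close>.\<close>

locale simple_ext =
  fixes A :: "'b::comm_ring_1 set" and x :: 'b and P :: "'b set"
  assumes A: "subring A" and P: "is_prime_ideal_in (adjoin A x) P"
begin

lemmas B = subring_adjoin[OF A, of x]
lemmas PI = prime_ideal[OF P]

lemma poly_in_ideal:
  assumes "\<And>i. coeff q i \<in> P"
  shows "poly q x \<in> P"
  unfolding poly_altdef
proof -
  have "finite J \<Longrightarrow> (\<Sum>i\<in>J. coeff q i * x ^ i) \<in> P" for J :: "nat set"
    by (induction J rule: finite_induct)
      (use assms in \<open>auto intro!: ideal_0[OF PI] ideal_add[OF PI] ideal_mult_right[OF PI]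
        subring_power[OF B] adjoin_generator[OF A]\<close>)
  then show "(\<Sum>i\<le>degree q. coeff q i * x ^ i) \<in> P" by simp
qed

text \<open>A leading coefficient in \<open>P\<close> is zero in the quotient, so its term can be
  removed without changing the residue class of the value. In arguments with a polynomial of least
  degree this forces the leading coefficient out of \<open>P\<close>.\<close>

lemma drop_lead:
  assumes "q \<in> polys_over A" "lead_coeff q \<in> P"
  shows "poly (q - monom (lead_coeff q) (degree q)) x - poly q x \<in> P"
proof -
  have "lead_coeff q * x ^ degree q \<in> P"
    using assms by (intro ideal_mult_right[OF PI]) (auto intro: subring_power[OF B] adjoin_generator[OF A])
  then show ?thesis
    using ideal_diff[OF B PI ideal_0[OF PI]] by (simp add: poly_monom)
qed

text \<open>\<open>M\<close> plays the role of the minimal polynomial of the residue class of \<open>x\<close> over the fraction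
  field of \<open>A / (P \<inter> A)\<close>; the other polynomials with a root there are multiples of it up to
  powers of its leading coefficient.\<close>

lemma ex_minimal_poly:
  assumes "q0 \<in> polys_over A" "poly q0 x \<in> P" "coeff q0 i0 \<notin> P"
  obtains M where "M \<in> polys_over A" "poly M x \<in> P" "lead_coeff M \<notin> P" "degree M > 0"
    "\<And>q i. q \<in> polys_over A \<Longrightarrow> poly q x \<in> P \<Longrightarrow> degree q < degree M \<Longrightarrow> coeff q i \<in> P"
proof -
  define T where "T = {q \<in> polys_over A. poly q x \<in> P \<and> (\<exists>i. coeff q i \<notin> P)}"
  have "q0 \<in> T" using assms by (auto simp: T_def)
  then obtain M where M: "M \<in> T" and min: "\<And>q. degree q < degree M \<Longrightarrow> q \<notin> T"
    using exists_least_iff[of "\<lambda>n. \<exists>q\<in>T. degree q = n"] by blast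
  \<comment> \<open>Otherwise the leading term could be dropped: the value stays in
    \<open>P\<close>, a coefficient outside \<open>P\<close> survives, and the degree falls.\<close>
  have lead: "lead_coeff M \<notin> P"
  proof
    assume l: "lead_coeff M \<in> P"
    obtain i where i: "coeff M i \<notin> P" using M by (auto simp: T_def)
    have "i \<le> degree M" using i le_degree ideal_0[OF PI] by metis
    moreover have "i \<noteq> degree M" using l i by auto
    ultimately have pos: "degree M > 0" "i \<noteq> degree M" by auto
    let ?M = "M - monom (lead_coeff M) (degree M)"
    have "?M \<in> polys_over A"
      using M A by (intro polys_over_closed) (auto simp: T_def coeff_polys_over)
    moreover have "poly ?M x \<in> P"
        using drop_lead[of M] l M ideal_diff_cancel[OF B PI] unfolding T_def by blast
    moreover have "coeff ?M i \<notin> P" using i pos by simp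
    ultimately have "?M \<in> T" unfolding T_def by blast
    then show False using min poly_drop_lead[OF pos(1)] by blast
  qed
  \<comment> \<open>A constant \<open>M\<close> equals its value at \<open>x\<close>, which would
    put its leading coefficient into \<open>P\<close>.\<close>
  have "degree M > 0"
  proof (rule ccontr)
    assume "\<not> degree M > 0"
    then have "poly M x = lead_coeff M" by (auto simp: poly_altdef)
    then show False using lead M by (auto simp: T_def)
  qed
  then show ?thesis using that[of M] M lead min by (auto simp: T_def)
qed

text \<open>The hypothesis on \<open>q0\<close> says that \<open>x\<close> is algebraic modulo
  \<open>P\<close>, so a nonzero residue class \<open>u\<close> becomes invertible once elements of
  \<open>A\<close> outside \<open>P\<close> are inverted; \<open>w / v\<close> is the inverse. A
  Euclidean descent yields \<open>v\<close>: a polynomial of least degree whose value lies in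
  \<open>u B + P\<close> but not in \<open>P\<close>, with \<open>B = A[x]\<close>, must be
  constant.\<close>

lemma algebraic_inverse:
  assumes "q0 \<in> polys_over A" "poly q0 x \<in> P" "coeff q0 i0 \<notin> P"
    and u: "u \<in> adjoin A x" "u \<notin> P"
  obtains w v where "w \<in> adjoin A x" "v \<in> A" "v \<notin> P" "u * w - v \<in> P"
proof -
  obtain M where M: "M \<in> polys_over A" "poly M x \<in> P" "lead_coeff M \<notin> P" "degree M > 0"
    and Mmin: "\<And>q i. q \<in> polys_over A \<Longrightarrow> poly q x \<in> P \<Longrightarrow> degree q < degree M \<Longrightarrow> coeff q i \<in> P"
    using ex_minimal_poly[OF assms(1-3)] by blast
  \<comment> \<open>\<open>J\<close> is the ideal \<open>u B + P\<close>, for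
    \<open>B = A[x]\<close>.\<close>
  define J where "J = {b. \<exists>w\<in>adjoin A x. u * w - b \<in> P}"
  have J_lin: "r * a - s * b \<in> J" if ab: "a \<in> J" "b \<in> J" "r \<in> adjoin A x" "s \<in> adjoin A x" for a b r s
  proof -
    obtain w w' where w: "w \<in> adjoin A x" "w' \<in> adjoin A x" "u * w - a \<in> P" "u * w' - b \<in> P"
      using ab unfolding J_def by blast
    have "u * (r * w - s * w') - (r * a - s * b) = r * (u * w - a) - s * (u * w' - b)"
      by (simp add: algebra_simps)
    also have "\<dots> \<in> P"
      by (rule ideal_diff[OF B PI ideal_mult_left[OF PI ab(3) w(3)] ideal_mult_left[OF PI ab(4) w(4)]])
    finally show ?thesis
      using w ab B unfolding J_def by (auto intro!: bexI[of _ "r * w - s * w'"] subring_closed)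
  qed
  have PJ: "b \<in> J" if "b \<in> P" for b
    using ideal_diff[OF B PI ideal_0[OF PI] that] subring_0[OF B] unfolding J_def
    by (auto intro!: bexI[of _ 0])
  define T where "T = {q \<in> polys_over A. poly q x \<in> J \<and> poly q x \<notin> P}"
  obtain qu where qu: "qu \<in> polys_over A" "u = poly qu x" using u by (auto simp: adjoin_def)
  have "qu \<in> T"
    using qu u ideal_0[OF PI] subring_1[OF B] by (auto simp: T_def J_def intro!: bexI[of _ 1])
  then obtain G where G: "G \<in> T" and min: "\<And>q. degree q < degree G \<Longrightarrow> q \<notin> T"
    using exists_least_iff[of "\<lambda>n. \<exists>q\<in>T. degree q = n"] by blast
  have GT: "G \<in> polys_over A" "poly G x \<in> J" "poly G x \<notin> P" using G by (auto simp: T_def)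
  have AB: "a \<in> adjoin A x" if "a \<in> A" for a using adjoin_base[OF A that] .
  have lA: "lead_coeff G \<in> A" "lead_coeff M \<in> A" using GT M by (auto simp: coeff_polys_over)
  have deg0: "degree G = 0"
  proof (rule ccontr)
    assume pos: "degree G \<noteq> 0"
    \<comment> \<open>Dropping a leading term with coefficient in \<open>P\<close> changes the value
      only by an element of \<open>P\<close>, hence of \<open>J\<close>, and would give a smaller
      member of \<open>T\<close>.\<close>
    have lead: "lead_coeff G \<notin> P"
    proof
      assume l: "lead_coeff G \<in> P"
      let ?G = "G - monom (lead_coeff G) (degree G)"
      have d: "poly ?G x - poly G x \<in> P" using drop_lead GT l by blast
      have "?G \<in> polys_over A"
        using GT lA A by (intro polys_over_closed) auto
      moreover have "poly ?G x \<in> J"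
        using J_lin[OF PJ[OF d] GT(2), of 1 "-1"] B by (auto simp: subring_closed)
      moreover have "poly ?G x \<notin> P"
        using ideal_diff[OF B PI _ d, of "poly ?G x"] GT(3) by auto
      ultimately have "?G \<in> T" by (auto simp: T_def)
      then show False using min poly_drop_lead pos by blast
    qed
    show False
    proof (cases "degree M \<le> degree G")
      \<comment> \<open>Divide \<open>G\<close> by \<open>M\<close>. Modulo \<open>P\<close> the
        remainder has the value of \<open>G\<close> times a power of the leading coefficient of
        \<open>M\<close>, so it is a member of \<open>T\<close> of smaller degree.\<close>
      case True
      obtain k q r where d: "q \<in> polys_over A" "r \<in> polys_over A"
        "smult (lead_coeff M ^ k) G = q * M + r" "degree r < degree M"
        using pseudo_division_polys_over[OF A M(1,4) GT(1)] by blast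
      have e: "poly r x = lead_coeff M ^ k * poly G x - poly q x * poly M x"
        using arg_cong[OF d(3), of "\<lambda>p. poly p x"] by simp
      have "poly r x \<in> J" unfolding e
        using GT PJ M d lA by (intro J_lin) (auto intro!: AB subring_power[OF A] poly_adjoin)
      moreover have "poly r x \<notin> P"
      proof
        assume "poly r x \<in> P"
        moreover have "poly q x * poly M x \<in> P"
          using M d by (intro ideal_mult_left[OF PI] poly_adjoin)
        ultimately have "lead_coeff M ^ k * poly G x \<in> P"
          using ideal_diff_cancel[OF B PI] e by metis
        then have "lead_coeff M ^ k \<in> P"
          using prime_mult[OF P AB[OF subring_power[OF A lA(2)]] poly_adjoin[OF GT(1)]] GT by blast
        then show False using prime_power[OF B P AB[OF lA(2)]] M by blast
      qed
      ultimately show False using min[of r] d True by (auto simp: T_def)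
    next
      \<comment> \<open>Divide \<open>M\<close> by \<open>G\<close> instead. The value of the
        remainder lies in \<open>J\<close>, and in \<open>P\<close> by minimality of
        \<open>G\<close>; hence the quotient \<open>q\<close> has value in \<open>P\<close>, and
        since its degree is below that of \<open>M\<close>, all its coefficients lie in
        \<open>P\<close>.\<close>
      case False
      obtain k q r where d: "q \<in> polys_over A" "r \<in> polys_over A"
        "smult (lead_coeff G ^ k) M = q * G + r" "degree r < degree G"
        "degree q \<le> degree M - degree G"
        using pseudo_division_polys_over[OF A GT(1) _ M(1)] pos by blast
      have e: "poly r x = lead_coeff G ^ k * poly M x - poly q x * poly G x"
        using arg_cong[OF d(3), of "\<lambda>p. poly p x"] by simp
      have "poly r x \<in> J" unfolding e
        using GT PJ M d lA by (intro J_lin) (auto intro!: AB subring_power[OF A] poly_adjoin)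
      then have "poly r x \<in> P" using min[of r] d by (auto simp: T_def)
      moreover have "lead_coeff G ^ k * poly M x \<in> P"
        using M lA by (intro ideal_mult_left[OF PI] AB subring_power[OF A])
      ultimately have "poly q x * poly G x \<in> P"
        using ideal_diff[OF B PI, of "lead_coeff G ^ k * poly M x" "poly r x"] e by simp
      then have "poly q x \<in> P"
        using prime_mult[OF P poly_adjoin poly_adjoin] d GT by blast
      moreover have "degree q < degree M" using d(5) pos False by linarith
      ultimately have q: "coeff q i \<in> P" for i using Mmin d(1) by blast
      \<comment> \<open>Comparing coefficients at \<open>degree M\<close>, where \<open>r\<close>
        contributes nothing, puts a product of elements outside the prime \<open>P\<close> into
        \<open>P\<close>.\<close>
      have "coeff r (degree M) = 0" using d(4) False by (intro coeff_eq_0) auto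
      then have "lead_coeff G ^ k * lead_coeff M = coeff (q * G) (degree M)"
        using arg_cong[OF d(3), of "\<lambda>p. coeff p (degree M)"] by simp
      also have "\<dots> \<in> P"
      proof -
        have "finite I \<Longrightarrow> (\<Sum>i\<in>I. coeff q i * coeff G (degree M - i)) \<in> P" for I
          by (induction I rule: finite_induct)
            (use q in \<open>auto intro!: ideal_0[OF PI] ideal_add[OF PI] ideal_mult_right[OF PI]
              AB coeff_polys_over[OF GT(1)]\<close>)
        then show ?thesis by (simp add: coeff_mult)
      qed
      finally have "lead_coeff G ^ k \<in> P \<or> lead_coeff M \<in> P"
        using prime_mult[OF P AB AB] subring_power[OF A] lA by blast
      then show False using M lead prime_power[OF B P AB[OF lA(1)]] by blast
    qed
  qed
  then have "poly G x = lead_coeff G" by (simp add: poly_altdef)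
  then show ?thesis using that[of _ "lead_coeff G"] lA GT by (auto simp: J_def)
qed

end


subsection \<open>Multivariate polynomials\<close>

abbreviation mpolys :: "'a::zero set \<Rightarrow> nat set \<Rightarrow> 'a mpol set" where
  "mpolys K V \<equiv> {p. poly_over K V p}"

lemma subring_subfield: "is_subfield K \<Longrightarrow> subring K"
  unfolding subring_def is_subfield_def by (metis diff_conv_add_uminus)

lemma subring_mpolys:
  assumes K: "subring K"
  shows "subring (mpolys K V)"
  unfolding subring_def
proof (intro conjI ballI)
  show "1 \<in> mpolys K V"
    using K by (auto simp: poly_over_def lookup_one when_def subring_closed)
  fix p q assume "p \<in> mpolys K V" "q \<in> mpolys K V"
  then have p: "\<And>m. Poly_Mapping.lookup p m \<in> K" "\<And>m. m \<in> Poly_Mapping.keys p \<Longrightarrow> Poly_Mapping.keys m \<subseteq> V"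
    and q: "\<And>m. Poly_Mapping.lookup q m \<in> K" "\<And>m. m \<in> Poly_Mapping.keys q \<Longrightarrow> Poly_Mapping.keys m \<subseteq> V"
    by (auto simp: poly_over_def)
  have "Poly_Mapping.keys (p - q) \<subseteq> Poly_Mapping.keys p \<union> Poly_Mapping.keys q"
    by (auto simp: in_keys_iff lookup_minus)
  then show "p - q \<in> mpolys K V"
    using p q K by (fastforce simp: poly_over_def lookup_minus subring_closed)
  have "Poly_Mapping.lookup (p * q) m \<in> K" for m
    unfolding lookup_mult Sum_any.expand_set
    using p q K by (auto intro!: subring_sum subring_mult subring_0 simp: when_def)
  moreover have "Poly_Mapping.keys m \<subseteq> V" if "m \<in> Poly_Mapping.keys (p * q)" for m
  proof -
    have "m \<in> {a + b |a b. a \<in> Poly_Mapping.keys p \<and> b \<in> Poly_Mapping.keys q}"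
      using that keys_mult[of p q] by blast
    then obtain a b where "m = a + b" "a \<in> Poly_Mapping.keys p" "b \<in> Poly_Mapping.keys q"
      by blast
    then show ?thesis using p(2)[of a] q(2)[of b] Poly_Mapping.keys_add[of a b] by auto
  qed
  ultimately show "p * q \<in> mpolys K V" by (simp add: poly_over_def)
qed

lemma mpolys_mono: "V \<subseteq> V' \<Longrightarrow> mpolys K V \<subseteq> mpolys K V'"
  by (force simp: poly_over_def)

lemma single_mpolys:
  "subring K \<Longrightarrow> c \<in> K \<Longrightarrow> Poly_Mapping.keys m \<subseteq> V \<Longrightarrow> Poly_Mapping.single m c \<in> mpolys K V"
  by (auto simp: poly_over_def lookup_single when_def subring_0)

lemma Var_mpolys: "subring K \<Longrightarrow> i \<in> V \<Longrightarrow> Var i \<in> mpolys K V"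
  unfolding Var_def by (intro single_mpolys) (auto simp: subring_1)

lemma mpol_sum_singles:
  "p = (\<Sum>m\<in>Poly_Mapping.keys p. Poly_Mapping.single m (Poly_Mapping.lookup p m))"
  by (intro poly_mapping_eqI) (auto simp: lookup_sum lookup_single when_def in_keys_iff)

lemma Var_power: "Var i ^ k = Poly_Mapping.single (Poly_Mapping.single i k) 1"
proof (induction k)
  case (Suc k)
  then show ?case
    by (simp add: Var_def mult_single flip: single_add)
qed simp

text \<open>Each monomial splits into a part free of variable \<open>i\<close> and a power of that
  variable. This makes the results on simple extensions available one variable at a time.\<close>

lemma mpolys_insert:
  assumes K: "subring K"
  shows "mpolys K (insert i V) = adjoin (mpolys K V) (Var i)"
proof
  note R = subring_mpolys[OF K]
  note B = subring_adjoin[OF R[of V], of "Var i"]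
  show "mpolys K (insert i V) \<subseteq> adjoin (mpolys K V) (Var i)"
  proof
    fix p assume p: "p \<in> mpolys K (insert i V)"
    have "Poly_Mapping.single m (Poly_Mapping.lookup p m) \<in> adjoin (mpolys K V) (Var i)"
      if "m \<in> Poly_Mapping.keys p" for m
    proof -
      \<comment> \<open>\<open>m'\<close> is \<open>m\<close> with the exponent of variable
        \<open>i\<close> erased.\<close>
      define m' where "m' = Poly_Mapping.update i 0 m"
      have m: "m = m' + Poly_Mapping.single i (Poly_Mapping.lookup m i)"
        by (intro poly_mapping_eqI) (auto simp: m'_def lookup_update lookup_add lookup_single when_def)
      have "Poly_Mapping.keys m' \<subseteq> V"
      proof
        fix j assume "j \<in> Poly_Mapping.keys m'"
        then have "j \<noteq> i" "j \<in> Poly_Mapping.keys m"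
          by (auto simp: m'_def in_keys_iff lookup_update split: if_splits)
        then show "j \<in> V" using p that by (auto simp: poly_over_def)
      qed
      then have "Poly_Mapping.single m' (Poly_Mapping.lookup p m) \<in> adjoin (mpolys K V) (Var i)"
        using p K by (intro adjoin_base[OF R] single_mpolys) (auto simp: poly_over_def)
      moreover have "Poly_Mapping.single m (Poly_Mapping.lookup p m) =
          Poly_Mapping.single m' (Poly_Mapping.lookup p m) * Var i ^ Poly_Mapping.lookup m i"
        unfolding Var_power mult_single using m by simp
      ultimately show ?thesis
        by (auto intro!: subring_mult[OF B] subring_power[OF B] adjoin_generator[OF R])
    qed
    then show "p \<in> adjoin (mpolys K V) (Var i)"
      by (subst mpol_sum_singles) (rule subring_sum[OF B])
  qed
  have "poly q (Var i) \<in> mpolys K (insert i V)" if "q \<in> polys_over (mpolys K V)" for q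
    unfolding poly_altdef
    using coeff_polys_over[OF that] mpolys_mono[of V "insert i V" K]
    by (intro subring_sum[OF R] subring_mult[OF R] subring_power[OF R] Var_mpolys[OF K]) auto
  then show "adjoin (mpolys K V) (Var i) \<subseteq> mpolys K (insert i V)"
    by (auto simp: adjoin_def)
qed

section \<open>Evaluation as a ring homomorphism\<close>

definition mon_eval :: "(nat \<Rightarrow>\<^sub>0 nat) \<Rightarrow> (nat \<Rightarrow> 'a::comm_ring_1) \<Rightarrow> 'a" where
  "mon_eval m a = (\<Prod>i\<in>Poly_Mapping.keys m. a i ^ Poly_Mapping.lookup m i)"

lemma mon_eval_superset:
  assumes "finite I" "Poly_Mapping.keys m \<subseteq> I"
  shows "mon_eval m a = (\<Prod>i\<in>I. a i ^ Poly_Mapping.lookup m i)"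
  unfolding mon_eval_def using assms
  by (intro prod.mono_neutral_left) (auto simp: in_keys_iff)

lemma mon_eval_add: "mon_eval (m + m') a = mon_eval m a * mon_eval m' a"
proof -
  define I where "I = Poly_Mapping.keys m \<union> Poly_Mapping.keys m'"
  have I: "finite I" "Poly_Mapping.keys m \<subseteq> I" "Poly_Mapping.keys m' \<subseteq> I"
    "Poly_Mapping.keys (m + m') \<subseteq> I"
    using Poly_Mapping.keys_add[of m m'] by (auto simp: I_def)
  show ?thesis
    unfolding mon_eval_superset[OF I(1,2)] mon_eval_superset[OF I(1,3)] mon_eval_superset[OF I(1,4)]
    by (simp add: lookup_add power_add prod.distrib)
qed

lemma meval_superset:
  assumes "finite I" "Poly_Mapping.keys p \<subseteq> I"
  shows "meval p a = (\<Sum>m\<in>I. Poly_Mapping.lookup p m * mon_eval m a)"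
  unfolding meval_def mon_eval_def using assms
  by (intro sum.mono_neutral_left) (auto simp: in_keys_iff)

lemma meval_single: "meval (Poly_Mapping.single m c) a = c * mon_eval m a"
  using meval_superset[of "{m}" "Poly_Mapping.single m c" a] by simp

lemma meval_0 [simp]: "meval 0 a = 0"
  by (simp add: meval_def)

lemma meval_add: "meval (p + q) a = meval p a + meval q a"
proof -
  define I where "I = Poly_Mapping.keys p \<union> Poly_Mapping.keys q"
  have I: "finite I" "Poly_Mapping.keys p \<subseteq> I" "Poly_Mapping.keys q \<subseteq> I"
    "Poly_Mapping.keys (p + q) \<subseteq> I"
    using Poly_Mapping.keys_add[of p q] by (auto simp: I_def)
  show ?thesis
    unfolding meval_superset[OF I(1,2)] meval_superset[OF I(1,3)] meval_superset[OF I(1,4)]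
    by (simp add: lookup_add distrib_right sum.distrib)
qed

lemma meval_diff: "meval (p - q) a = meval p a - meval q a"
  using meval_add[of "p - q" q a] by simp

lemma meval_sum: "meval (sum g I) a = (\<Sum>i\<in>I. meval (g i) a)"
  by (induction I rule: infinite_finite_induct) (auto simp: meval_add)

lemma meval_mult: "meval (p * q) a = meval p a * meval q a"
proof -
  have single: "meval (Poly_Mapping.single m c * q) a = c * mon_eval m a * meval q a" for m c
  proof -
    have "Poly_Mapping.single m c * q = (\<Sum>m'\<in>Poly_Mapping.keys q.
        Poly_Mapping.single (m + m') (c * Poly_Mapping.lookup q m'))"
      by (subst mpol_sum_singles[of q]) (simp add: sum_distrib_left mult_single)
    then have "meval (Poly_Mapping.single m c * q) a = (\<Sum>m'\<in>Poly_Mapping.keys q.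
        c * Poly_Mapping.lookup q m' * (mon_eval m a * mon_eval m' a))"
      by (simp add: meval_sum meval_single mon_eval_add)
    also have "\<dots> = c * mon_eval m a * meval q a"
      by (simp add: meval_superset[OF finite_keys order_refl] sum_distrib_left algebra_simps)
    finally show ?thesis .
  qed
  have "p * q = (\<Sum>m\<in>Poly_Mapping.keys p. Poly_Mapping.single m (Poly_Mapping.lookup p m) * q)"
    by (subst mpol_sum_singles[of p]) (simp add: sum_distrib_right)
  then show ?thesis
    by (simp add: meval_sum single meval_superset[OF finite_keys order_refl, of p] sum_distrib_right)
qed

lemma meval_1 [simp]: "meval 1 a = 1"
  using meval_single[of 0 1 a] by (simp add: mon_eval_def)

lemma meval_power: "meval (p ^ k) a = meval p a ^ k"
  by (induction k) (auto simp: meval_mult)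

lemma meval_Var [simp]: "meval (Var i) a = a i"
  by (simp add: Var_def meval_single mon_eval_def)

lemma meval_cong:
  assumes "p \<in> mpolys K V" "\<And>i. i \<in> V \<Longrightarrow> a i = b i"
  shows "meval p a = meval p b"
  unfolding meval_def
  using assms by (intro sum.cong prod.cong arg_cong2[of _ _ _ _ times] refl)
    (fastforce simp: poly_over_def)

text \<open>With the other coordinates fixed, evaluation becomes that of a one-variable polynomial
  in \<open>b\<close>, because the coefficients do not see coordinate \<open>i\<close>.\<close>

lemma meval_poly_Var:
  assumes "q \<in> polys_over (mpolys K V)" "i \<notin> V"
  shows "meval (poly q (Var i)) (a(i := b)) = (\<Sum>k\<le>degree q. meval (coeff q k) a * b ^ k)"
proof -
  have "meval (coeff q k) (a(i := b)) = meval (coeff q k) a" for k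
    using assms by (intro meval_cong[of _ K V] coeff_polys_over) auto
  then show ?thesis
    by (simp add: poly_altdef meval_sum meval_mult meval_power)
qed

subsection \<open>Nullstellensatz and algebraic dependence\<close>

text \<open>No counting of roots is needed: a nonconstant polynomial \<open>p\<close> takes the
  value 1 at any root of \<open>p - 1\<close>.\<close>

lemma alg_closed_nonroot:
  fixes f :: "nat \<Rightarrow> 'a::alg_closed_field"
  assumes "j \<le> N" "f j \<noteq> 0"
  obtains b where "(\<Sum>k\<le>N. f k * b ^ k) \<noteq> 0"
proof -
  define p where "p = (\<Sum>k\<le>N. monom (f k) k)"
  have "coeff p j = f j" using assms by (simp add: p_def coeff_sum)
  then have "p \<noteq> 0" using assms by auto
  have "\<exists>b. poly p b \<noteq> 0"
  proof (cases "degree p = 0")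
    case True
    then have "poly p 0 = lead_coeff p" by (simp add: poly_altdef)
    then show ?thesis using \<open>p \<noteq> 0\<close> by (metis leading_coeff_0_iff)
  next
    case False
    then have "degree (p - 1) > 0"
      by (metis diff_add_cancel degree_add_le degree_1 neq0_conv le_0_eq)
    then obtain b where "poly (p - 1) b = 0" using alg_closed_imp_poly_has_root by blast
    then have "poly p b = 1" by simp
    then show ?thesis by (metis zero_neq_one)
  qed
  then show ?thesis using that by (auto simp: p_def poly_sum poly_monom)
qed

text \<open>A form of the Nullstellensatz relative to a subfield: a point of the zero set of
  \<open>P \<inter> K[x\<^sub>0, \<dots>, x\<^sub>n\<^sub>-\<^sub>1]\<close> outside a suitable hypersurface extends to a
  point of the zero set of \<open>P\<close>.\<close>

lemma prime_ideal_ex_zero: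
  fixes K :: "'a::alg_closed_field set"
  assumes K: "is_subfield K" and "is_prime_ideal_in (mpolys K {..<n}) P"
    and "u \<in> mpolys K {..<n}" "u \<notin> P"
  shows "\<exists>a\<in>zero_set n P. meval u a \<noteq> 0"
  using assms(2-)
proof (induction n arbitrary: P u)
  case 0
  have const: "p = Poly_Mapping.single 0 (Poly_Mapping.lookup p 0)" if "p \<in> mpolys K {..<0}" for p
  proof (rule poly_mapping_eqI)
    fix m
    have "m \<in> Poly_Mapping.keys p \<Longrightarrow> m = 0" using that by (auto simp: poly_over_def)
    then show "Poly_Mapping.lookup p m = Poly_Mapping.lookup (Poly_Mapping.single 0 (Poly_Mapping.lookup p 0)) m"
      by (auto simp: lookup_single when_def in_keys_iff)
  qed
  note PI = prime_ideal[OF "0.prems"(1)]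
  \<comment> \<open>Without variables the ring is \<open>K\<close>, so a nonzero element of
    \<open>P\<close> would be a unit.\<close>
  have "p = 0" if p: "p \<in> P" for p
  proof (rule ccontr)
    assume "p \<noteq> 0"
    have pR: "p \<in> mpolys K {..<0}" using ideal_subset[OF PI p] .
    define c where "c = Poly_Mapping.lookup p 0"
    have pc: "p = Poly_Mapping.single 0 c" using const[OF pR] c_def by simp
    have c: "c \<noteq> 0" using \<open>p \<noteq> 0\<close> pc by auto
    have "c \<in> K" using pR by (simp add: c_def poly_over_def)
    have "Poly_Mapping.single 0 (inverse c) \<in> mpolys K {..<0}"
      using c \<open>c \<in> K\<close> K by (intro single_mpolys subring_subfield) (auto simp: is_subfield_def)
    then have "Poly_Mapping.single 0 (inverse c) * p \<in> P" using ideal_mult_left[OF PI] p by blast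
    then show False using prime_not_1[OF "0.prems"(1)] c by (simp add: pc mult_single)
  qed
  moreover have "u \<noteq> 0" using "0.prems" ideal_0[OF PI] by blast
  then have "Poly_Mapping.lookup u 0 \<noteq> 0" using const[OF "0.prems"(2)] by (metis single_zero)
  then have "meval u (\<lambda>_. 0) \<noteq> 0"
    by (subst const[OF "0.prems"(2)]) (simp add: meval_single mon_eval_def)
  ultimately show ?case by (intro bexI[of _ "\<lambda>_. 0"]) (force simp: zero_set_def)+
next
  case (Suc n)
  define A where "A = mpolys K {..<n}"
  have A: "subring A" unfolding A_def by (intro subring_mpolys subring_subfield K)
  have ext: "mpolys K {..<Suc n} = adjoin A (Var n)"
    unfolding lessThan_Suc A_def by (intro mpolys_insert subring_subfield K)
  interpret simple_ext A "Var n" P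
    using A Suc.prems ext by unfold_locales auto
  have PA: "is_prime_ideal_in A (P \<inter> A)"
    using adjoin_base[OF A] by (intro prime_ideal_restrict[OF A _ P]) blast
  \<comment> \<open>The induction hypothesis is used for the contraction of \<open>P\<close> to the
    ring without the last variable.\<close>
  have IH: "\<exists>a\<in>zero_set n (P \<inter> A). meval v a \<noteq> 0" if "v \<in> A" "v \<notin> P" for v
    using Suc.IH[of "P \<inter> A" v] that PA by (auto simp: A_def)
  have ev: "meval (poly q (Var n)) (a(n := b)) = (\<Sum>k\<le>degree q. meval (coeff q k) a * b ^ k)"
    if "q \<in> polys_over A" for q a b
    using that unfolding A_def by (intro meval_poly_Var) auto
  have zeroI: "a(n := b) \<in> zero_set (Suc n) P"
    if a: "a \<in> zero_set n (P \<inter> A)" and zero: "\<And>q. q \<in> polys_over A \<Longrightarrow> poly q (Var n) \<in> P \<Longrightarrow>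
      meval (poly q (Var n)) (a(n := b)) = 0" for a b
  proof -
    have "meval p (a(n := b)) = 0" if "p \<in> P" for p
      using that ideal_subset[OF PI that] zero by (auto simp: adjoin_def)
    moreover have "(a(n := b)) i = 0" if "i \<ge> Suc n" for i
      using a that by (auto simp: zero_set_def)
    ultimately show ?thesis by (simp add: zero_set_def)
  qed
  show ?case
  proof (cases "\<exists>q\<in>polys_over A. poly q (Var n) \<in> P \<and> (\<exists>i. coeff q i \<notin> P)")
    \<comment> \<open>The last variable is transcendental modulo \<open>P\<close>: a polynomial has
      value in \<open>P\<close> only if all its coefficients are in \<open>P\<close>. Every
      \<open>b\<close> then extends a zero \<open>a\<close> of the contraction, and \<open>b\<close>
      only has to keep \<open>u\<close> nonzero.\<close>
    case False
    obtain qu where qu: "qu \<in> polys_over A" "u = poly qu (Var n)"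
      using Suc.prems ext by (auto simp: adjoin_def)
    obtain j where j: "coeff qu j \<notin> P" using poly_in_ideal[of qu] qu Suc.prems by auto
    obtain a where a: "a \<in> zero_set n (P \<inter> A)" "meval (coeff qu j) a \<noteq> 0"
      using IH[OF coeff_polys_over[OF qu(1)] j] by blast
    have "j \<le> degree qu" using j ideal_0[OF PI] le_degree by metis
    then obtain b where b: "(\<Sum>k\<le>degree qu. meval (coeff qu k) a * b ^ k) \<noteq> 0"
      using alg_closed_nonroot[of j _ "\<lambda>k. meval (coeff qu k) a"] a by blast
    have "a(n := b) \<in> zero_set (Suc n) P"
    proof (rule zeroI[OF a(1)])
      fix q assume q: "q \<in> polys_over A" "poly q (Var n) \<in> P"
      have "coeff q k \<in> P \<inter> A" for k using False q coeff_polys_over[OF q(1)] by blast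
      then show "meval (poly q (Var n)) (a(n := b)) = 0"
        using a(1) by (auto simp: ev[OF q(1)] zero_set_def)
    qed
    moreover have "meval u (a(n := b)) \<noteq> 0" using b ev[OF qu(1)] qu(2) by simp
    ultimately show ?thesis by blast
  next
    \<comment> \<open>The last variable is algebraic modulo \<open>P\<close>, so \<open>b\<close>
      must be a root of the minimal polynomial \<open>M\<close> specialised at
      \<open>a\<close>.\<close>
    case True
    then obtain q0 i0 where q0: "q0 \<in> polys_over A" "poly q0 (Var n) \<in> P" "coeff q0 i0 \<notin> P"
      by blast
    obtain M where M: "M \<in> polys_over A" "poly M (Var n) \<in> P" "lead_coeff M \<notin> P" "degree M > 0"
      and Mmin: "\<And>q i. q \<in> polys_over A \<Longrightarrow> poly q (Var n) \<in> P \<Longrightarrow> degree q < degree M \<Longrightarrow> coeff q i \<in> P"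
      using ex_minimal_poly[OF q0] by blast
    \<comment> \<open>Since \<open>u w = v\<close> on the zero set of \<open>P\<close>, nonvanishing
      of \<open>u\<close> reduces to that of \<open>v\<close>, which involves only the earlier
      variables.\<close>
    obtain w v where w: "w \<in> adjoin A (Var n)" "v \<in> A" "v \<notin> P" "u * w - v \<in> P"
      using algebraic_inverse[OF q0, of u] Suc.prems ext by blast
    have lA: "lead_coeff M \<in> A" using M by (simp add: coeff_polys_over)
    have "lead_coeff M * v \<notin> P" using prime_mult[OF P adjoin_base[OF A lA] adjoin_base[OF A w(2)]] M w by blast
    then obtain a where a: "a \<in> zero_set n (P \<inter> A)" "meval (lead_coeff M * v) a \<noteq> 0"
      using IH[OF subring_mult[OF A lA w(2)]] by blast
    then have l0: "meval (lead_coeff M) a \<noteq> 0" and v0: "meval v a \<noteq> 0" by (auto simp: meval_mult)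
    \<comment> \<open>The leading coefficient does not vanish at \<open>a\<close>, so
      \<open>M\<close> keeps its positive degree under specialisation and has a root.\<close>
    obtain b where "(\<Sum>k\<le>degree M. meval (coeff M k) a * b ^ k) = 0"
      using alg_closed[of "degree M" "\<lambda>k. meval (coeff M k) a"] M(4) l0 by blast
    then have Mb: "meval (poly M (Var n)) (a(n := b)) = 0" using ev[OF M(1)] by simp
    have evA: "meval c (a(n := b)) = meval c a" if "c \<in> A" for c
      using that unfolding A_def by (rule meval_cong) auto
    have zero: "a(n := b) \<in> zero_set (Suc n) P"
    proof (rule zeroI[OF a(1)])
      fix q assume q: "q \<in> polys_over A" "poly q (Var n) \<in> P"
      \<comment> \<open>Up to a power of the leading coefficient, \<open>q\<close> is a multiple of
        \<open>M\<close> plus a remainder \<open>s\<close>. By minimality of \<open>M\<close> the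
        coefficients of \<open>s\<close> lie in \<open>P \<inter> A\<close> and hence vanish at
        \<open>a\<close>.\<close>
      obtain k r s where d: "r \<in> polys_over A" "s \<in> polys_over A"
        "smult (lead_coeff M ^ k) q = r * M + s" "degree s < degree M"
        using pseudo_division_polys_over[OF A M(1,4) q(1)] by blast
      have e: "lead_coeff M ^ k * poly q (Var n) = poly r (Var n) * poly M (Var n) + poly s (Var n)"
        using arg_cong[OF d(3), of "\<lambda>p. poly p (Var n)"] by simp
      then have "poly s (Var n) = lead_coeff M ^ k * poly q (Var n) - poly r (Var n) * poly M (Var n)"
        by simp
      also have "\<dots> \<in> P"
        using q M d lA by (intro ideal_diff[OF B PI] ideal_mult_left[OF PI] poly_adjoin
            adjoin_base[OF A] subring_power[OF A])
      finally have "coeff s i \<in> P \<inter> A" for i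
        using Mmin d coeff_polys_over[OF d(2)] by blast
      then have "meval (poly s (Var n)) (a(n := b)) = 0"
        using a(1) by (auto simp: ev[OF d(2)] zero_set_def)
      then have "meval (lead_coeff M) a ^ k * meval (poly q (Var n)) (a(n := b)) = 0"
        using arg_cong[OF e, of "\<lambda>p. meval p (a(n := b))"] Mb evA[OF lA]
        by (simp add: meval_add meval_mult meval_power)
      then show "meval (poly q (Var n)) (a(n := b)) = 0" using l0 by simp
    qed
    then have "meval (u * w - v) (a(n := b)) = 0" using w by (auto simp: zero_set_def)
    then have "meval u (a(n := b)) \<noteq> 0" using v0 evA[OF w(2)] by (auto simp: meval_diff meval_mult)
    then show ?thesis using zero by blast
  qed
qed

text \<open>An element outside \<open>P\<close> is nonzero somewhere on the zero set of
  \<open>P\<close>. This is what translates conditions on components into conditions on minimal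
  primes.\<close>

lemma vanishing_ideal_zero_set_prime:
  fixes K :: "'a::alg_closed_field set"
  assumes "is_subfield K" "is_prime_ideal_in (mpolys K {..<n}) P"
  shows "vanishing_ideal K n (zero_set n P) = P"
  using prime_ideal_ex_zero[OF assms] ideal_subset[OF prime_ideal[OF assms(2)]]
  by (fastforce simp: vanishing_ideal_def zero_set_def)

text \<open>If all variables are algebraic over \<open>K(x\<^sub>0, \<dots>, x\<^sub>d\<^sub>-\<^sub>1)\<close> modulo \<open>P\<close>, then the
  localisation of \<open>K[X] / P\<close> at \<open>K[Y] - {0}\<close> is a field.\<close>

lemma algebraic_inverse_mpolys:
  fixes K :: "'a::field set"
  assumes K: "subring K" and P: "is_prime_ideal_in (mpolys K {..<n}) P"
    and alg: "\<And>i. d \<le> i \<Longrightarrow> i < n \<Longrightarrow> \<exists>p\<in>P. p \<in> mpolys K (insert i {..<d}) \<and> p \<noteq> 0"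
    and indep: "P \<inter> mpolys K {..<d} = {0}"
    and "d \<le> j" "j \<le> n" "u \<in> mpolys K {..<j}" "u \<notin> P"
  shows "\<exists>w\<in>mpolys K {..<j}. \<exists>s\<in>mpolys K {..<d}. s \<notin> P \<and> u * w - s \<in> P"
  using assms(5-)
proof (induction j arbitrary: u rule: dec_induct)
  case base
  \<comment> \<open>Here \<open>u\<close> already lies in K[Y], so \<open>w = 1\<close> and
    \<open>s = u\<close> work.\<close>
  then show ?case
    using ideal_0[OF prime_ideal[OF P]] subring_1[OF subring_mpolys[OF K]]
    by (intro bexI[of _ 1] bexI[of _ u]) auto
next
  case (step j)
  note PI' = prime_ideal[OF P]
  define A where "A = mpolys K {..<j}"
  have A: "subring A" unfolding A_def by (intro subring_mpolys K)
  have ext: "mpolys K {..<Suc j} = adjoin A (Var j)"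
    unfolding lessThan_Suc A_def by (intro mpolys_insert K)
  have sub: "mpolys K {..<Suc j} \<subseteq> mpolys K {..<n}" using step by (intro mpolys_mono) auto
  interpret simple_ext A "Var j" "P \<inter> mpolys K {..<Suc j}"
    using A prime_ideal_restrict[OF subring_mpolys[OF K] sub P] ext by unfold_locales auto
  have AB: "A \<subseteq> mpolys K {..<Suc j}" unfolding A_def by (intro mpolys_mono) auto
  \<comment> \<open>The dependence of variable \<open>j\<close> is read as a polynomial
    \<open>q\<close> in it over K[Y]; its leading coefficient is a nonzero element of K[Y], hence
    outside \<open>P\<close> by independence.\<close>
  obtain p where p: "p \<in> P" "p \<in> mpolys K (insert j {..<d})" "p \<noteq> 0"
    using alg[of j] step by auto
  then obtain q where q: "q \<in> polys_over (mpolys K {..<d})" "p = poly q (Var j)"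
    using mpolys_insert[OF K, of j "{..<d}"] by (auto simp: adjoin_def)
  have dA: "mpolys K {..<d} \<subseteq> A" unfolding A_def using step by (intro mpolys_mono) auto
  have qA: "q \<in> polys_over A" using q dA by (auto simp: polys_over_def)
  have "q \<noteq> 0" using p q by auto
  then have "lead_coeff q \<notin> P" using indep coeff_polys_over[OF q(1)] leading_coeff_0_iff by blast
  moreover have "poly q (Var j) \<in> P \<inter> mpolys K {..<Suc j}"
    using p q poly_adjoin[OF qA] ext by auto
  ultimately obtain w v where "w \<in> adjoin A (Var j)" "v \<in> A"
      "v \<notin> P \<inter> mpolys K {..<Suc j}" "u * w - v \<in> P \<inter> mpolys K {..<Suc j}"
    using algebraic_inverse[OF qA, of "degree q" u] step.prems ext by blast
  then have w: "w \<in> mpolys K {..<Suc j}" "v \<in> A" "v \<notin> P" "u * w - v \<in> P"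
    using ext AB by auto
  then obtain w' s where w': "w' \<in> A" "s \<in> mpolys K {..<d}" "s \<notin> P" "v * w' - s \<in> P"
    using step.IH[of v] step.prems by (auto simp: A_def)
  \<comment> \<open>Two inversions are chained: \<open>w\<close> brings \<open>u\<close> down to
    \<open>v\<close>, which lacks variable \<open>j\<close>, and \<open>w'\<close> brings
    \<open>v\<close> down to \<open>s\<close> in K[Y].\<close>
  have "w' * (u * w - v) + (v * w' - s) \<in> P"
  proof (intro ideal_add[OF PI'] ideal_mult_left[OF PI'])
    show "w' \<in> mpolys K {..<n}" using w' AB sub by blast
  qed (use w w' in auto)
  moreover have "w' * (u * w - v) + (v * w' - s) = u * (w * w') - s"
    by (simp add: algebra_simps)
  moreover have "w * w' \<in> mpolys K {..<Suc j}"
    using w w' AB by (intro subring_mult[OF subring_mpolys[OF K]]) auto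
  ultimately show ?case using w' by metis
qed

subsection \<open>Generated ideals and the elimination criteria\<close>

lemma ideal_gen_ideal:
  assumes K: "subring K" and hs: "set hs \<subseteq> mpolys K V"
  shows "is_ideal_in (mpolys K V) (ideal_gen K V hs)"
  unfolding is_ideal_in_def
proof (intro conjI ballI)
  note R = subring_mpolys[OF K, of V]
  have memI: "(\<Sum>i<length hs. c i * hs ! i) \<in> ideal_gen K V hs" if "\<And>i. c i \<in> mpolys K V" for c
    using that by (auto simp: ideal_gen_def)
  show "ideal_gen K V hs \<subseteq> mpolys K V"
  proof
    fix p assume "p \<in> ideal_gen K V hs"
    then obtain c where c: "p = (\<Sum>i<length hs. c i * hs ! i)" "\<forall>i<length hs. poly_over K V (c i)"
      by (auto simp: ideal_gen_def)
    show "p \<in> mpolys K V" unfolding c(1)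
      using c(2) hs nth_mem by (intro subring_sum[OF R] subring_mult[OF R]) blast+
  qed
  show "0 \<in> ideal_gen K V hs" using memI[of "\<lambda>_. 0"] subring_0[OF R] by simp
  show "p + q \<in> ideal_gen K V hs" if pq: "p \<in> ideal_gen K V hs" "q \<in> ideal_gen K V hs" for p q
  proof -
    obtain c c' where c: "p = (\<Sum>i<length hs. c i * hs ! i)" "\<forall>i<length hs. poly_over K V (c i)"
      "q = (\<Sum>i<length hs. c' i * hs ! i)" "\<forall>i<length hs. poly_over K V (c' i)"
      using pq by (auto simp: ideal_gen_def)
    have "p + q = (\<Sum>i<length hs. (c i + c' i) * hs ! i)"
      by (simp add: c sum.distrib distrib_right)
    moreover have "\<forall>i<length hs. poly_over K V (c i + c' i)"
      using c subring_add[OF R] by simp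
    ultimately show ?thesis unfolding ideal_gen_def by (intro CollectI exI[of _ "\<lambda>i. c i + c' i"]) simp
  qed
  show "r * p \<in> ideal_gen K V hs" if rp: "r \<in> mpolys K V" "p \<in> ideal_gen K V hs" for r p
  proof -
    obtain c where c: "p = (\<Sum>i<length hs. c i * hs ! i)" "\<forall>i<length hs. poly_over K V (c i)"
      using rp by (auto simp: ideal_gen_def)
    have "r * p = (\<Sum>i<length hs. (r * c i) * hs ! i)"
      by (simp add: c sum_distrib_left mult.assoc)
    moreover have "\<forall>i<length hs. poly_over K V (r * c i)"
      using c rp subring_mult[OF R] by simp
    ultimately show ?thesis unfolding ideal_gen_def by (intro CollectI exI[of _ "\<lambda>i. r * c i"]) simp
  qed
qed

lemma generator_in_ideal_gen:
  assumes K: "subring K" and h: "h \<in> set hs"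
  shows "h \<in> ideal_gen K V hs"
proof -
  note R = subring_mpolys[OF K, of V]
  obtain j where j: "j < length hs" "hs ! j = h" using h by (auto simp: in_set_conv_nth)
  have "(\<Sum>i<length hs. (if i = j then 1 else 0) * hs ! i) = (\<Sum>i<length hs. if i = j then hs ! i else 0)"
    by (intro sum.cong) auto
  also have "\<dots> = h" using j by simp
  finally have "h = (\<Sum>i<length hs. (if i = j then 1 else 0) * hs ! i)" by simp
  moreover have "\<forall>i. poly_over K V (if i = j then 1 else 0)"
    using subring_0[OF R] subring_1[OF R] by simp
  ultimately show ?thesis unfolding ideal_gen_def
    by (intro CollectI exI[of _ "\<lambda>i. if i = j then 1 else 0"]) simp
qed

lemma ideal_gen_mono:
  assumes "subring K" "V \<subseteq> V'" "set hs \<subseteq> set hs'" "set hs' \<subseteq> mpolys K V'"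
  shows "ideal_gen K V hs \<subseteq> ideal_gen K V' hs'"
proof
  fix p assume "p \<in> ideal_gen K V hs"
  then obtain c where c: "p = (\<Sum>i<length hs. c i * hs ! i)" "\<forall>i<length hs. poly_over K V (c i)"
    by (auto simp: ideal_gen_def)
  note I = ideal_gen_ideal[OF assms(1,4)]
  have "finite J \<Longrightarrow> J \<subseteq> {..<length hs} \<Longrightarrow> (\<Sum>i\<in>J. c i * hs ! i) \<in> ideal_gen K V' hs'" for J
  proof (induction J rule: finite_induct)
    case (insert i J)
    then have "hs ! i \<in> ideal_gen K V' hs'" "c i \<in> mpolys K V'"
      using assms(3) c(2) mpolys_mono[OF assms(2), of K] nth_mem
      by (auto intro!: generator_in_ideal_gen[OF assms(1)])
    then show ?case using insert ideal_add[OF I] ideal_mult_left[OF I] by auto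
  qed (simp add: ideal_0[OF I])
  then show "p \<in> ideal_gen K V' hs'" using c(1) by blast
qed

lemma meval_ideal_gen:
  assumes "p \<in> ideal_gen K V hs" "\<And>h. h \<in> set hs \<Longrightarrow> meval h a = 0"
  shows "meval p a = 0"
  using assms by (auto simp: ideal_gen_def meval_sum meval_mult)

theorem theorem1:
  fixes K :: "'a::alg_closed_field set"
    and n d :: nat
    and hs :: "'a mpol list"
    and f :: "'a mpol"
  assumes "is_subfield K"
    and "\<forall>h\<in>set hs. poly_over K {..<n} h"
    and "poly_over K {..<n} f"
    and "max_indep_vars K n (ideal_gen K {..<n} hs) d"
  shows "(generally_true K n d (ideal_gen K {..<n} hs) f \<longleftrightarrow>
           ideal_gen K {..<Suc n} (hs @ [f * Var n - 1]) \<inter> {p. poly_over K {..<d} p} \<noteq> {0}) \<and>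
         (generally_false K n d (ideal_gen K {..<n} hs) f \<longleftrightarrow>
           ideal_gen K {..<n} (hs @ [f]) \<inter> {p. poly_over K {..<d} p} \<noteq> {0})"
proof -
  define R where "R = mpolys K {..<n}"
  define Y where "Y = mpolys K {..<d}"
  define H where "H = ideal_gen K {..<n} hs"
  note K = subring_subfield[OF assms(1)]
  have R: "subring R" and Y: "subring Y" unfolding R_def Y_def by (intro subring_mpolys K)+
  have dn: "d \<le> n" using assms(4) by (simp add: max_indep_vars_def)
  have YR: "Y \<subseteq> R" unfolding R_def Y_def using dn by (intro mpolys_mono) auto
  have fR: "f \<in> R" and hsR: "set hs \<subseteq> R" using assms by (auto simp: R_def)
  have H: "is_ideal_in R H" unfolding H_def R_def using hsR by (intro ideal_gen_ideal K) (simp add: R_def)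
  have hsH: "set hs \<subseteq> H" using generator_in_ideal_gen[OF K] by (auto simp: H_def)
  have comp: "K_components K n H = zero_set n ` minimal_primes R H"
    by (simp add: K_components_def R_def)
  have min: "is_prime_ideal_in R P" "H \<subseteq> P" "vanishing_ideal K n (zero_set n P) = P"
    if "P \<in> minimal_primes R H" for P
    using that vanishing_ideal_zero_set_prime[OF assms(1)] by (auto simp: minimal_primes_def R_def)
  have van: "(\<forall>a\<in>zero_set n P. meval g a = 0) \<longleftrightarrow> g \<in> P"
    if "P \<in> minimal_primes R H" "g \<in> R" for P g
  proof -
    have "g \<in> vanishing_ideal K n (zero_set n P) \<longleftrightarrow> (\<forall>a\<in>zero_set n P. meval g a = 0)"
      using that(2) by (simp add: vanishing_ideal_def R_def)
    then show ?thesis using min(3)[OF that(1)] by simp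
  qed
  have true_iff: "generally_true K n d H f \<longleftrightarrow> (\<forall>P\<in>minimal_primes R H. P \<inter> Y = {0} \<longrightarrow> f \<in> P)"
    unfolding generally_true_def comp non_degenerate_def Y_def ball_simps(9)
    by (intro ball_cong refl) (simp add: min(3) van[OF _ fR])
  have false_iff: "generally_false K n d H f \<longleftrightarrow> (\<forall>P\<in>minimal_primes R H. P \<inter> Y = {0} \<longrightarrow> f \<notin> P)"
    unfolding generally_false_def comp non_degenerate_def Y_def ball_simps(9)
    by (intro ball_cong refl) (simp add: min(3) van[OF _ fR])
  \<comment> \<open>Variables are numbered from 0, so \<open>Var n\<close> is the first one not
    occurring in K[X] and serves as t.\<close>
  define It where "It = ideal_gen K {..<Suc n} (hs @ [f * Var n - 1])"
  define If where "If = ideal_gen K {..<n} (hs @ [f])"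
  define R' where "R' = mpolys K {..<Suc n}"
  have R': "subring R'" unfolding R'_def by (intro subring_mpolys K)
  have RR': "R \<subseteq> R'" unfolding R_def R'_def by (intro mpolys_mono) auto
  have VR': "Var n \<in> R'" unfolding R'_def by (intro Var_mpolys K) auto
  have ft: "set (hs @ [f * Var n - 1]) \<subseteq> R'"
    using hsR fR RR' VR' R' by (auto intro!: subring_diff subring_mult subring_1)
  have It: "is_ideal_in R' It" unfolding It_def R'_def using ft by (intro ideal_gen_ideal K) (simp add: R'_def)
  have HIt: "H \<subseteq> It" unfolding It_def H_def
    using ft by (intro ideal_gen_mono K) (auto simp: R'_def)
  have If: "is_ideal_in R If" unfolding If_def R_def
    using hsR fR by (intro ideal_gen_ideal K) (auto simp: R_def)
  have HIf: "H \<subseteq> If" unfolding If_def H_def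
    using hsR fR by (intro ideal_gen_mono K) (auto simp: R_def)
  have fIf: "f \<in> If" unfolding If_def by (intro generator_in_ideal_gen K) auto
  have zero_hs: "meval h a = 0" if "P \<in> minimal_primes R H" "a \<in> zero_set n P" "h \<in> set hs" for P a h
    using that(2) hsH min(2)[OF that(1)] that(3) by (auto simp: zero_set_def)

  \<comment> \<open>Criterion (a): generally true statements\<close>
  have "generally_true K n d H f \<longleftrightarrow> It \<inter> Y \<noteq> {0}"
  proof
    assume gt: "generally_true K n d H f"
    show "It \<inter> Y \<noteq> {0}"
    proof
      assume none: "It \<inter> Y = {0}"
      \<comment> \<open>A prime missing \<open>S\<close> is non-degenerate (exponent 0) and does not
        contain \<open>f\<close> (take \<open>s = 1\<close>, exponent 1).\<close>
      define S where "S = {s * f ^ k |s k. s \<in> Y \<and> s \<noteq> 0}"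
      have SI: "s * f ^ k \<in> S" if "s \<in> Y" "s \<noteq> 0" for s k using that by (auto simp: S_def)
      have one: "1 \<in> S" using SI[of 1 0] subring_1[OF Y] by simp
      have SR: "S \<subseteq> R"
        using YR fR R by (auto simp: S_def intro!: subring_mult subring_power)
      have mult: "x * y \<in> S" if xy: "x \<in> S" "y \<in> S" for x y
      proof -
        obtain s k s' k' where "x = s * f ^ k" "y = s' * f ^ k'" "s \<in> Y" "s \<noteq> 0" "s' \<in> Y" "s' \<noteq> 0"
          using xy by (auto simp: S_def)
        then show ?thesis using SI[of "s * s'" "k + k'"] subring_mult[OF Y]
          by (simp add: power_add algebra_simps)
      qed
      \<comment> \<open>Modulo \<open>It\<close> the power \<open>Var n ^ k\<close> is inverse to
        \<open>f ^ k\<close>.\<close>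
      have pow: "(f * Var n) ^ k - 1 \<in> It" for k
      proof (induction k)
        case 0
        then show ?case using ideal_0[OF It] by simp
      next
        case (Suc k)
        have "(f * Var n) ^ Suc k - 1 = f * Var n * ((f * Var n) ^ k - 1) + (f * Var n - 1)"
          by (simp add: algebra_simps)
        moreover have "f * Var n - 1 \<in> It" unfolding It_def by (intro generator_in_ideal_gen K) simp
        moreover have "f * Var n \<in> R'" using fR RR' VR' subring_mult[OF R'] by blast
        ultimately show ?case using Suc ideal_add[OF It] ideal_mult_left[OF It] by metis
      qed
      have "H \<inter> S = {}"
      proof (rule ccontr)
        assume "H \<inter> S \<noteq> {}"
        then obtain s k where s: "s \<in> Y" "s \<noteq> 0" "s * f ^ k \<in> H" by (auto simp: S_def)
        \<comment> \<open>Cancelling \<open>f ^ k\<close> with its inverse modulo \<open>It\<close>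
          exhibits \<open>s\<close> itself as an element of \<open>It\<close>.\<close>
        have "Var n ^ k * (s * f ^ k) - s * ((f * Var n) ^ k - 1) \<in> It"
        proof (rule ideal_diff[OF R' It])
          show "Var n ^ k * (s * f ^ k) \<in> It"
            using s HIt by (intro ideal_mult_left[OF It subring_power[OF R' VR']]) blast
          show "s * ((f * Var n) ^ k - 1) \<in> It"
            using s YR RR' pow by (intro ideal_mult_left[OF It]) auto
        qed
        moreover have "Var n ^ k * (s * f ^ k) - s * ((f * Var n) ^ k - 1) = s"
          by (simp add: algebra_simps power_mult_distrib)
        ultimately show False using s none by auto
      qed
      then obtain Q where Q: "is_prime_ideal_in R Q" "H \<subseteq> Q" "Q \<inter> S = {}"
        using ex_prime_avoiding[OF R H one SR mult] by blast
      obtain P where P: "P \<in> minimal_primes R H" "P \<subseteq> Q"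
        using ex_minimal_prime_below[OF R Q(1,2)] by blast
      have "s \<notin> P" if "s \<in> Y" "s \<noteq> 0" for s
        using SI[OF that, of 0] Q(3) P(2) by auto
      then have "P \<inter> Y = {0}"
        using ideal_0[OF prime_ideal[OF min(1)[OF P(1)]]] subring_0[OF Y] by auto
      then have "f \<in> P" using gt P(1) true_iff by blast
      moreover have "f \<in> S" using SI[of 1 1] subring_1[OF Y] by simp
      ultimately show False using P(2) Q(3) by blast
    qed
  next
    assume "It \<inter> Y \<noteq> {0}"
    then obtain s where s: "s \<in> It" "s \<in> Y" "s \<noteq> 0"
      using ideal_0[OF It] subring_0[OF Y] by blast
    have "f \<in> P" if P: "P \<in> minimal_primes R H" and nd: "P \<inter> Y = {0}" for P
    proof -
      \<comment> \<open>It suffices that \<open>s * f\<close> vanishes on the zero set of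
        \<open>P\<close>: then \<open>s * f\<close> is in \<open>P\<close>, while non-degeneracy
        keeps \<open>s\<close> out.\<close>
      have "meval (s * f) a = 0" if a: "a \<in> zero_set n P" for a
      proof (cases "meval f a = 0")
        case False
        \<comment> \<open>Rabinowitsch: extend \<open>a\<close> by the value of \<open>1 / f\<close>.\<close>
        define a' where "a' = a(n := inverse (meval f a))"
        have ev: "meval g a' = meval g a" if "g \<in> R" for g
          using that unfolding R_def a'_def by (rule meval_cong) auto
        have "meval s a' = 0"
        proof (rule meval_ideal_gen)
          show "s \<in> ideal_gen K {..<Suc n} (hs @ [f * Var n - 1])" using s It_def by simp
          fix h assume "h \<in> set (hs @ [f * Var n - 1])"
          then show "meval h a' = 0"
            using zero_hs[OF P a] ev hsR ev[OF fR] False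
            by (auto simp: meval_diff meval_mult a'_def)
        qed
        then show ?thesis using ev s YR by (auto simp: meval_mult)
      qed (simp add: meval_mult)
      then have "s * f \<in> P" using van[OF P subring_mult[OF R _ fR]] s YR by blast
      then show ?thesis using prime_mult[OF min(1)[OF P] _ fR] s YR nd by blast
    qed
    then show "generally_true K n d H f" using true_iff by blast
  qed

  \<comment> \<open>Criterion (b): generally false statements\<close>
  moreover have "generally_false K n d H f \<longleftrightarrow> If \<inter> Y \<noteq> {0}"
  proof
    assume gf: "generally_false K n d H f"
    show "If \<inter> Y \<noteq> {0}"
    proof
      assume none: "If \<inter> Y = {0}"
      have "If \<inter> (Y - {0}) = {}" using none by blast
      moreover have "1 \<in> Y - {0}" "Y - {0} \<subseteq> R" using subring_1[OF Y] YR by auto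
      moreover have "x * y \<in> Y - {0}" if "x \<in> Y - {0}" "y \<in> Y - {0}" for x y
        using that subring_mult[OF Y] by auto
      ultimately obtain Q where Q: "is_prime_ideal_in R Q" "If \<subseteq> Q" "Q \<inter> (Y - {0}) = {}"
        using ex_prime_avoiding[OF R If] by metis
      obtain P where P: "P \<in> minimal_primes R H" "P \<subseteq> Q"
        using ex_minimal_prime_below[OF R Q(1)] Q(2) HIf by blast
      note PP = min(1)[OF P(1)]
      have nd: "P \<inter> Y = {0}"
        using P(2) Q(3) ideal_0[OF prime_ideal[OF PP]] subring_0[OF Y] by blast
      then have "f \<notin> P" using gf P(1) false_iff by blast
      \<comment> \<open>Adding one variable to Y gives a set of \<open>d + 1\<close> variables,
        which is dependent for \<open>H\<close>, and thus for \<open>P\<close>, by maximality of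
        Y.\<close>
      have alg: "\<exists>p\<in>P. p \<in> mpolys K (insert i {..<d}) \<and> p \<noteq> 0" if "d \<le> i" "i < n" for i
      proof -
        have "insert i {..<d} \<subseteq> {..<n}" "card (insert i {..<d}) > d" using that by auto
        then have "H \<inter> mpolys K (insert i {..<d}) \<noteq> {0}"
          using assms(4) unfolding max_indep_vars_def H_def by blast
        moreover have "0 \<in> H \<inter> mpolys K (insert i {..<d})"
          using ideal_0[OF H] subring_0[OF subring_mpolys[OF K]] by blast
        ultimately show ?thesis using min(2)[OF P(1)] by blast
      qed
      obtain w s where w: "w \<in> R" "s \<in> Y" "s \<notin> P" "f * w - s \<in> P"
        using algebraic_inverse_mpolys[OF K PP[unfolded R_def] alg nd[unfolded Y_def] dn order_refl
            fR[unfolded R_def] \<open>f \<notin> P\<close>]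
        by (auto simp: R_def Y_def)
      \<comment> \<open>Both \<open>f * w\<close> and \<open>f * w - s\<close> lie in
        \<open>Q\<close>, so \<open>s\<close> does too; but \<open>Q\<close> contains no nonzero
        element of K[Y].\<close>
      have "f * w \<in> Q" using w fIf Q(2) by (intro ideal_mult_right[OF prime_ideal[OF Q(1)]]) auto
      then have "f * w - (f * w - s) \<in> Q"
        using ideal_diff[OF R prime_ideal[OF Q(1)], of "f * w" "f * w - s"] w P(2) by blast
      then have "s = 0" using w Q(3) by auto
      then show False using w ideal_0[OF prime_ideal[OF PP]] by blast
    qed
  next
    assume "If \<inter> Y \<noteq> {0}"
    then obtain s where s: "s \<in> If" "s \<in> Y" "s \<noteq> 0"
      using ideal_0[OF If] subring_0[OF Y] by blast
    have False if P: "P \<in> minimal_primes R H" and nd: "P \<inter> Y = {0}" and fP: "f \<in> P" for P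
    proof -
      \<comment> \<open>If \<open>f\<close> is in \<open>P\<close>, all generators of
        \<open>If\<close> vanish on the zero set of \<open>P\<close>; hence \<open>s\<close> does
        and lies in \<open>P\<close>, against non-degeneracy.\<close>
      have "meval s a = 0" if a: "a \<in> zero_set n P" for a
      proof (rule meval_ideal_gen)
        show "s \<in> ideal_gen K {..<n} (hs @ [f])" using s If_def by simp
        show "meval h a = 0" if "h \<in> set (hs @ [f])" for h
          using that zero_hs[OF P a] van[OF P fR] fP a by auto
      qed
      then show False using van[OF P, of s] s YR nd by blast
    qed
    then show "generally_false K n d H f" using false_iff by blast
  qed
  ultimately show ?thesis by (simp add: It_def If_def H_def Y_def)
qed

end
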